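(* The coarse disjoint union of any expander sequence does not have Property A.
   Context: Graphs are undirected with vertex set $V(G)$. For $A\subseteq V(G)$, $\partial A$ is the set of edges joining a vertex of $A$ to a vertex outside $A$. The Cheeger constant of a finite graph is $h(G)=\min\{|\partial A|/|A| : A\subseteq V(G),\ 0<|A|\le |V(G)|/2\}$. A finite graph is a $(k,\varepsilon)$-expander if each vertex has degree at most $k$ and $h(G)\ge\varepsilon>0$. A sequence of finite connected graphs $\{G_i\}$ with $|V(G_i)|\to\infty$ is an expander sequence if there exist $k,\varepsilon$ such that each $G_i$ is a $(k,\varepsilon)$-expander. Each $G_i$ is regarded as a metric space (its vertex set with the graph metric). The coarse disjoint union of a sequence $\{(X_n,d_n)\}$ of bounded metric spaces is the disjoint union of all $X_n$ with the metric $d$ given by $d=d_n$ on $X_n\times X_n$ and $d(x,y)=\operatorname{diam}(X_i)+\operatorname{diam}(X_j)$ if $x\in X_i$, $y\in X_j$, $i\ne j$. A metric space $X$ has Property A if for each $R>0$ and each $\epsilon>0$ there is $S>0$ and a function $A$ from $X$ to finite subsets of $X\times\mathbb{N}$ such that $A(x)\subset B(x,S)\times\mathbb{N}$ for each $x\in X$, where $B(x,S)=\{y:d(x,y)<S\}$, and if $d(x,y)<R$, then $A(x)\cap A(y)\neq\emptyset$ and $\frac{|A(x)\Delta A(y)|}{|A(x)\cap A(y)|}<\epsilon$. *)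

theory Defs
  imports "HOL-Analysis.Analysis" "Graph_Theory.Graph_Theory"
begin

section \<open>Expander sequences\<close>

text \<open>
  Finite simple undirected graphs are the symmetric digraphs of locale \<^locale>\<open>graph\<close>: an
  undirected edge is represented by its two opposite arcs.  Hence the number of neighbours of a
  vertex is its \<^const>\<open>out_degree\<close>, and the edges joining \<open>A\<close> to its complement correspond
  one-to-one to the arcs that leave \<open>A\<close>.
\<close>

definition edge_boundary :: "('a, 'b) pre_digraph \<Rightarrow> 'a set \<Rightarrow> 'b set" where
  "edge_boundary G A = {e \<in> arcs G. tail G e \<in> A \<and> head G e \<in> verts G - A}"

text \<open>
  The minimum exists exactly when \<open>G\<close> has at least two vertices (see \<open>cheeger_eq_Min\<close>); writing
  it as an infimum of extended reals gives one-vertex graphs the constant \<open>\<infinity>\<close>.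
\<close>

definition cheeger :: "('a, 'b) pre_digraph \<Rightarrow> ereal" where
  "cheeger G =
    (INF A \<in> {A. A \<subseteq> verts G \<and> 0 < card A \<and> real (card A) \<le> real (card (verts G)) / 2}.
       ereal (real (card (edge_boundary G A)) / real (card A)))"

definition expander :: "nat \<Rightarrow> real \<Rightarrow> ('a, 'b) pre_digraph \<Rightarrow> bool" where
  "expander k \<epsilon> G \<longleftrightarrow>
    graph G \<and> (\<forall>v \<in> verts G. out_degree G v \<le> k) \<and> ereal \<epsilon> \<le> cheeger G \<and> 0 < \<epsilon>"

definition expander_sequence :: "(nat \<Rightarrow> ('a, 'b) pre_digraph) \<Rightarrow> bool" where
  "expander_sequence G \<longleftrightarrow>
    (\<forall>i. graph (G i) \<and> Digraph_Component.connected (G i)) \<and>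
    filterlim (\<lambda>i. card (verts (G i))) at_top sequentially \<and>
    (\<exists>k \<epsilon>. \<forall>i. expander k \<epsilon> (G i))"

lemma cheeger_eq_Min:
  assumes "graph G" "2 \<le> card (verts G)"
  shows "cheeger G = ereal (Min ((\<lambda>A. real (card (edge_boundary G A)) / real (card A)) `
           {A. A \<subseteq> verts G \<and> 0 < card A \<and> real (card A) \<le> real (card (verts G)) / 2}))"
proof -
  let ?S = "{A. A \<subseteq> verts G \<and> 0 < card A \<and> real (card A) \<le> real (card (verts G)) / 2}"
  let ?f = "\<lambda>A. real (card (edge_boundary G A)) / real (card A)"
  interpret graph G by fact
  have "?S \<subseteq> Pow (verts G)"
    by blast
  then have fin: "finite ?S"
    by (rule finite_subset) simp
  have "verts G \<noteq> {}"
    using assms(2) by (intro notI) simp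
  then obtain v where "v \<in> verts G"
    by blast
  then have "{v} \<in> ?S"
    using assms(2) by simp
  then have ne: "?S \<noteq> {}"
    by blast
  show ?thesis
    unfolding cheeger_def
  proof (rule INF_eqI)
    fix A assume "A \<in> ?S"
    then have "Min (?f ` ?S) \<le> ?f A"
      using fin by (intro Min_le) auto
    then show "ereal (Min (?f ` ?S)) \<le> ereal (?f A)"
      by simp
  next
    fix y assume y: "\<And>A. A \<in> ?S \<Longrightarrow> y \<le> ereal (?f A)"
    have "Min (?f ` ?S) \<in> ?f ` ?S"
      using fin ne by (intro Min_in) auto
    then obtain A where "A \<in> ?S" "Min (?f ` ?S) = ?f A"
      by blast
    then show "y \<le> ereal (Min (?f ` ?S))"
      using y by simp
  qed
qed

section \<open>Graph metric and coarse disjoint union\<close>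

text \<open>
  \<open>\<mu>\<close> is the infimum of the weights of all walks between two vertices; with unit weights this is
  the length of a shortest path.
\<close>

definition graph_dist :: "('a, 'b) pre_digraph \<Rightarrow> 'a \<Rightarrow> 'a \<Rightarrow> real" where
  "graph_dist G u v = real_of_ereal (wf_digraph.\<mu> G (\<lambda>_. 1) u v)"

definition space_diameter :: "'a set \<Rightarrow> ('a \<Rightarrow> 'a \<Rightarrow> real) \<Rightarrow> real" where
  "space_diameter X d = (SUP (x, y) \<in> X \<times> X. d x y)"

definition coarse_union :: "(nat \<Rightarrow> 'a set) \<Rightarrow> (nat \<times> 'a) set" where
  "coarse_union X = (SIGMA n:UNIV. X n)"

definition coarse_union_dist ::
    "(nat \<Rightarrow> 'a set) \<Rightarrow> (nat \<Rightarrow> 'a \<Rightarrow> 'a \<Rightarrow> real) \<Rightarrow> nat \<times> 'a \<Rightarrow> nat \<times> 'a \<Rightarrow> real" where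
  "coarse_union_dist X d = (\<lambda>(i, x) (j, y).
     if i = j then d i x y else space_diameter (X i) (d i) + space_diameter (X j) (d j))"

text \<open>
  A carrier set and a distance function are passed separately, and the metric axioms are not part
  of the definition: a coarse disjoint union with two one-point pieces is only a pseudometric
  space.  In all other cases it is a metric space (see \<open>Metric_space_coarse_union\<close>).
\<close>

definition property_A :: "'a set \<Rightarrow> ('a \<Rightarrow> 'a \<Rightarrow> real) \<Rightarrow> bool" where
  "property_A X d \<longleftrightarrow>
    (\<forall>R > 0. \<forall>\<epsilon> > 0. \<exists>S > 0. \<exists>A :: 'a \<Rightarrow> ('a \<times> nat) set.
      (\<forall>x \<in> X. finite (A x) \<and> A x \<subseteq> {y \<in> X. d x y < S} \<times> UNIV) \<and>
      (\<forall>x \<in> X. \<forall>y \<in> X. d x y < R \<longrightarrow>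
         A x \<inter> A y \<noteq> {} \<and>
         real (card (sym_diff (A x) (A y))) / real (card (A x \<inter> A y)) < \<epsilon>))"

lemma awalk_sym_length:
  assumes "graph G" "pre_digraph.awalk G u p v"
  shows "\<exists>q. pre_digraph.awalk G v q u \<and> length q = length p"
proof -
  interpret graph G by fact
  show ?thesis
    using assms(2)
  proof (induction p arbitrary: u)
    case Nil
    then show ?case by (auto simp: awalk_Nil_iff)
  next
    case (Cons e p)
    then have e: "e \<in> arcs G" "u = tail G e" and p: "awalk (head G e) p v"
      by (auto simp: awalk_Cons_iff)
    obtain q where q: "awalk v q (head G e)" "length q = length p"
      using Cons.IH[OF p] by blast
    have "(head G e, tail G e) \<in> arcs_ends G"
      using e sym_arcs by (auto simp: symmetric_def sym_def arcs_ends_def arc_to_ends_def)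
    then obtain e' where "e' \<in> arcs G" "tail G e' = head G e" "head G e' = tail G e"
      by (auto simp: arcs_ends_def arc_to_ends_def)
    then have "awalk (head G e) [e'] u"
      using e by (simp add: awalk_Cons_iff awalk_Nil_iff)
    then have "awalk v (q @ [e']) u"
      using awalk_appendI[OF q(1)] by blast
    then show ?case
      using q by (intro exI[of _ "q @ [e']"]) simp
  qed
qed

lemma graph_dist_sym:
  assumes "graph G"
  shows "graph_dist G u v = graph_dist G v u"
proof -
  interpret graph G by fact
  have cost: "awalk_cost (\<lambda>_. 1) p = real (length p)" for p
    by (induction p) simp_all
  have "(\<lambda>p. ereal (awalk_cost (\<lambda>_. 1) p)) ` {p. awalk x p y}
      \<subseteq> (\<lambda>p. ereal (awalk_cost (\<lambda>_. 1) p)) ` {p. awalk y p x}" for x y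
  proof clarify
    fix p assume "awalk x p y"
    then obtain q where "awalk y q x" "length q = length p"
      using awalk_sym_length[OF assms] by blast
    then show "ereal (awalk_cost (\<lambda>_. 1) p)
        \<in> (\<lambda>p. ereal (awalk_cost (\<lambda>_. 1) p)) ` {p. awalk y p x}"
      by (intro image_eqI[of _ _ q]) (simp_all add: cost)
  qed
  then have "(\<lambda>p. ereal (awalk_cost (\<lambda>_. 1) p)) ` {p. awalk u p v}
      = (\<lambda>p. ereal (awalk_cost (\<lambda>_. 1) p)) ` {p. awalk v p u}"
    by (intro subset_antisym)
  then have "\<mu> (\<lambda>_. 1) u v = \<mu> (\<lambda>_. 1) v u"
    unfolding \<mu>_def by (rule arg_cong)
  then show ?thesis
    by (simp add: graph_dist_def)
qed

lemma graph_dist_le_length: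
  assumes "graph G" "pre_digraph.awalk G u p v"
  shows "graph_dist G u v \<le> real (length p)"
    and "\<exists>q. pre_digraph.awalk G u q v \<and> graph_dist G u v = real (length q)"
proof -
  interpret graph G by fact
  have cost: "awalk_cost (\<lambda>_. 1) p = real (length p)" for p
    by (induction p) simp_all
  have "u \<rightarrow>\<^sup>*\<^bsub>G\<^esub> v"
    using assms(2) by (rule reachable_awalkI)
  then obtain q where q: "apath u q v" "\<mu> (\<lambda>_. 1) u v = awalk_cost (\<lambda>_. 1) q"
    using min_cost_awalk[of u v "\<lambda>_. 1"] by auto
  then have d: "graph_dist G u v = real (length q)"
    by (simp add: graph_dist_def cost)
  then show "\<exists>q. awalk u q v \<and> graph_dist G u v = real (length q)"
    using q by (auto simp: apath_def)
  have "ereal (real (length q)) \<le> ereal (real (length p))"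
    using min_cost_le_walk_cost[OF assms(2), of "\<lambda>_. 1"] q by (simp add: cost)
  then show "graph_dist G u v \<le> real (length p)"
    using d by simp
qed

lemma Metric_space_graph_dist:
  fixes G :: "('a, 'b) pre_digraph"
  assumes "graph G" "Digraph_Component.connected G"
  shows "Metric_space (verts G) (graph_dist G)"
proof -
  interpret graph G by fact
  have "strongly_connected G"
    by (rule symmetric_connected_imp_strongly_connected[OF sym_arcs assms(2)])
  then have reach: "\<exists>p. awalk u p v" if "u \<in> verts G" "v \<in> verts G" for u v
    using that unfolding strongly_connected_def reachable_awalk by blast
  have shortest: "\<exists>p. awalk u p v \<and> graph_dist G u v = real (length p)"
    if uv: "u \<in> verts G" "v \<in> verts G" for u v
  proof -
    obtain p where "awalk u p v"
      using reach[OF uv] by blast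
    then show ?thesis
      by (rule graph_dist_le_length(2)[OF assms(1)])
  qed
  show ?thesis
  proof
    fix x y
    show "0 \<le> graph_dist G x y"
    proof (cases "\<exists>p. awalk x p y")
      case True
      then obtain p where "awalk x p y"
        by blast
      from graph_dist_le_length(2)[OF assms(1) this]
      obtain q :: "'b list" where "graph_dist G x y = real (length q)"
        by blast
      then show ?thesis
        by simp
    next
      case False
      then show ?thesis
        by (simp add: graph_dist_def shortest_path_inf reachable_awalk)
    qed
    show "graph_dist G x y = graph_dist G y x"
      by (rule graph_dist_sym[OF assms(1)])
  next
    fix x y assume xy: "x \<in> verts G" "y \<in> verts G"
    show "graph_dist G x y = 0 \<longleftrightarrow> x = y"
    proof
      assume "graph_dist G x y = 0"
      moreover obtain p where "awalk x p y" "graph_dist G x y = real (length p)"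
        using shortest[OF xy] by blast
      ultimately show "x = y"
        by (simp add: awalk_Nil_iff)
    next
      assume "x = y"
      then have "awalk x [] y"
        using xy by (simp add: awalk_Nil_iff)
      from graph_dist_le_length(1)[OF assms(1) this]
      have "graph_dist G x y \<le> 0"
        by simp
      moreover obtain p :: "'b list" where "graph_dist G x y = real (length p)"
        using shortest[OF xy] by blast
      ultimately show "graph_dist G x y = 0"
        by simp
    qed
  next
    fix x y z assume xyz: "x \<in> verts G" "y \<in> verts G" "z \<in> verts G"
    obtain p where p: "awalk x p y" "graph_dist G x y = real (length p)"
      using shortest[OF xyz(1,2)] by blast
    obtain q where q: "awalk y q z" "graph_dist G y z = real (length q)"
      using shortest[OF xyz(2,3)] by blast
    have "awalk x (p @ q) z"
      using awalk_appendI[OF p(1) q(1)] .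
    then have "graph_dist G x z \<le> real (length (p @ q))"
      by (rule graph_dist_le_length(1)[OF assms(1)])
    then show "graph_dist G x z \<le> graph_dist G x y + graph_dist G y z"
      using p(2) q(2) by simp
  qed
qed

lemma Metric_space_coarse_union:
  assumes metric: "\<And>i. Metric_space (X i) (d i)"
    and ne: "\<And>i. X i \<noteq> {}"
    and bdd: "\<And>i. bdd_above ((\<lambda>(x, y). d i x y) ` (X i \<times> X i))"
    and single: "\<And>i j x y. X i = {x} \<Longrightarrow> X j = {y} \<Longrightarrow> i = j"
  shows "Metric_space (coarse_union X) (coarse_union_dist X d)"
proof -
  let ?D = "\<lambda>i. space_diameter (X i) (d i)"
  have le: "d i x y \<le> ?D i" if "x \<in> X i" "y \<in> X i" for i x y
    unfolding space_diameter_def using cSUP_upper[of "(x, y)", OF _ bdd[of i]] that by simp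
  have pos: "0 \<le> d i x y" for i x y
    by (rule Metric_space.nonneg[OF metric])
  have Dpos: "0 \<le> ?D i" for i
  proof -
    obtain x where "x \<in> X i" using ne by blast
    then show ?thesis using le[of x i x] pos[of i x x] by linarith
  qed
  have D0: "\<exists>x. X i = {x}" if "?D i = 0" for i
  proof -
    obtain x where x: "x \<in> X i" using ne by blast
    have "y = x" if "y \<in> X i" for y
      using le[of y i x] pos[of i y x] \<open>?D i = 0\<close> x that Metric_space.zero[OF metric, of y i x]
      by simp
    then show ?thesis using x by blast
  qed
  show ?thesis
  proof
    fix p q
    show "0 \<le> coarse_union_dist X d p q"
      using pos Dpos by (auto simp: coarse_union_dist_def split: prod.splits)
    show "coarse_union_dist X d p q = coarse_union_dist X d q p"
    proof -
      obtain i x j y where pq: "p = (i, x)" "q = (j, y)"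
        by (cases p, cases q) blast
      have "d i x y = d i y x"
        by (rule Metric_space.commute[OF metric])
      then show ?thesis
        unfolding pq coarse_union_dist_def by simp
    qed
  next
    fix p q assume "p \<in> coarse_union X" "q \<in> coarse_union X"
    then obtain i x j y where p: "p = (i, x)" "x \<in> X i" and q: "q = (j, y)" "y \<in> X j"
      by (auto simp: coarse_union_def)
    show "coarse_union_dist X d p q = 0 \<longleftrightarrow> p = q"
    proof (cases "i = j")
      case True
      then show ?thesis
        using p q Metric_space.zero[OF metric] by (simp add: coarse_union_dist_def)
    next
      case False
      then have "?D i + ?D j \<noteq> 0"
        using D0[of i] D0[of j] single[of i _ j] Dpos[of i] Dpos[of j]
        by (auto simp: add_nonneg_eq_0_iff)
      then show ?thesis
        using False p q by (simp add: coarse_union_dist_def)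
    qed
  next
    fix p q r assume "p \<in> coarse_union X" "q \<in> coarse_union X" "r \<in> coarse_union X"
    then obtain i x j y k z where pqr: "p = (i, x)" "q = (j, y)" "r = (k, z)"
      and mem: "x \<in> X i" "y \<in> X j" "z \<in> X k"
      by (auto simp: coarse_union_def)
    consider "i = j" "j = k" | "i = j" "j \<noteq> k" | "i \<noteq> j" "j = k"
      | "i \<noteq> j" "j \<noteq> k" "i = k" | "i \<noteq> j" "j \<noteq> k" "i \<noteq> k"
      by blast
    then show "coarse_union_dist X d p r
        \<le> coarse_union_dist X d p q + coarse_union_dist X d q r"
    proof cases
      case 1
      then show ?thesis
        using Metric_space.triangle[OF metric, of x i y z] mem
        by (simp add: pqr coarse_union_dist_def)
    next
      case 2
      then show ?thesis
        using pos[of i x y] by (simp add: pqr coarse_union_dist_def)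
    next
      case 3
      then show ?thesis
        using pos[of j y z] by (simp add: pqr coarse_union_dist_def)
    next
      case 4
      then show ?thesis
        using le[of x i z] Dpos[of i] Dpos[of j] mem by (simp add: pqr coarse_union_dist_def)
    next
      case 5
      then show ?thesis
        using Dpos[of j] by (simp add: pqr coarse_union_dist_def)
    qed
  qed
qed

end

theory Submission
  imports Defs
begin

text \<open>
  Suppose that \<open>A\<close> witnesses Property A.  In a piece \<open>G i\<close> with many vertices, each set
  \<open>F u = {x. u \<in> A x}\<close> lies in a ball of fixed radius, hence is small because the degrees are
  bounded, and so has an edge boundary of size at least \<open>\<epsilon> |F u|\<close>.  Summing over \<open>u\<close> and
  counting the other way gives \<open>\<epsilon> (\<Sum>x. |A x|) \<le> (\<Sum>e. |A (tail e) - A (head e)|)\<close>, a sum over all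
  arcs \<open>e\<close>.  But by Property A the right-hand side is at most \<open>\<delta> k (\<Sum>x. |A x|)\<close> for
  arbitrarily small \<open>\<delta>\<close>.
\<close>

lemma expander_boundary_ge:
  assumes "expander k \<epsilon> G" "F \<subseteq> verts G" "2 * card F \<le> card (verts G)"
  shows "\<epsilon> * real (card F) \<le> real (card (edge_boundary G F))"
\<comment> \<open>The infimum in \<open>cheeger\<close> runs over sets of positive cardinality only;
  for \<open>card F = 0\<close> the left-hand side vanishes.\<close>
proof (cases "card F = 0")
  case False
  have "ereal \<epsilon> \<le> cheeger G"
    using assms(1) by (simp add: expander_def)
  also have "\<dots> \<le> ereal (real (card (edge_boundary G F)) / real (card F))"
    unfolding cheeger_def using assms(2,3) False by (intro INF_lower) auto
  finally show ?thesis
    using False by (simp add: field_simps)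
qed simp

lemma expander_sum_card_le:
  assumes G: "expander k \<epsilon> G"
    and fin: "\<And>x. x \<in> verts G \<Longrightarrow> finite (A x)"
    and small: "\<And>u. 2 * card {x \<in> verts G. u \<in> A x} \<le> card (verts G)"
  shows "\<epsilon> * (\<Sum>x\<in>verts G. real (card (A x)))
    \<le> (\<Sum>e\<in>arcs G. real (card (A (tail G e) - A (head G e))))"
proof -
  interpret graph G
    using G by (simp add: expander_def)
  \<comment> \<open>A point outside \<open>U\<close> lies in no \<open>A x\<close>, so the counts
    over all points \<open>u\<close> become finite sums over \<open>U\<close>.\<close>
  define U where "U = (\<Union>x\<in>verts G. A x)"
  define F where "F u = {x \<in> verts G. u \<in> A x}" for u
  have U: "finite U"
    using fin by (simp add: U_def)
  \<comment> \<open>This turns the boundary of a level set into a condition on the pair of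
    \<open>e\<close> and \<open>u\<close>, so that such pairs can be counted by arcs or by
    points.\<close>
  have boundary: "edge_boundary G (F u) = {e \<in> arcs G. u \<in> A (tail G e) - A (head G e)}" for u
    by (auto simp: edge_boundary_def F_def)
  have "card (A x) = card {u \<in> U. u \<in> A x}" if "x \<in> verts G" for x
    using that by (intro arg_cong[of _ _ card]) (auto simp: U_def)
  then have "(\<Sum>x\<in>verts G. card (A x)) = (\<Sum>u\<in>U. card (F u))"
    unfolding F_def using U
      sum_multicount_gen[of "verts G" U "\<lambda>x u. u \<in> A x" "\<lambda>u. card {x \<in> verts G. u \<in> A x}"]
    by simp
  moreover have "(\<Sum>e\<in>arcs G. card (A (tail G e) - A (head G e)))
      = (\<Sum>u\<in>U. card (edge_boundary G (F u)))"
  proof -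
    have "card (A (tail G e) - A (head G e)) = card {u \<in> U. u \<in> A (tail G e) - A (head G e)}"
      if "e \<in> arcs G" for e
      using that by (intro arg_cong[of _ _ card]) (auto simp: U_def)
    then have "(\<Sum>e\<in>arcs G. card (A (tail G e) - A (head G e)))
        = (\<Sum>e\<in>arcs G. card {u \<in> U. u \<in> A (tail G e) - A (head G e)})"
      by (intro sum.cong refl)
    also have "\<dots> = (\<Sum>u\<in>U. card (edge_boundary G (F u)))"
      unfolding boundary using U by (intro sum_multicount_gen) auto
    finally show ?thesis .
  qed
  moreover have "(\<Sum>u\<in>U. \<epsilon> * real (card (F u))) \<le> (\<Sum>u\<in>U. real (card (edge_boundary G (F u))))"
    using small unfolding F_def by (intro sum_mono expander_boundary_ge[OF G]) auto
  ultimately show ?thesis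
    by (simp flip: of_nat_sum sum_distrib_left)
qed

text \<open>Grouping the arcs by their tail counts \<open>f v\<close> once for each arc leaving
  \<open>v\<close>, hence at most \<open>k\<close> times.\<close>

lemma (in fin_digraph) sum_arcs_tail_le:
  fixes f :: "'a \<Rightarrow> real"
  assumes "\<And>v. v \<in> verts G \<Longrightarrow> out_degree G v \<le> k"
    and "\<And>v. v \<in> verts G \<Longrightarrow> 0 \<le> f v"
  shows "(\<Sum>e\<in>arcs G. f (tail G e)) \<le> real k * (\<Sum>v\<in>verts G. f v)"
proof -
  have "(\<Sum>e\<in>arcs G. f (tail G e)) = (\<Sum>v\<in>verts G. \<Sum>e | e \<in> arcs G \<and> tail G e = v. f (tail G e))"
    by (rule sum.group[symmetric]) auto
  also have "\<dots> = (\<Sum>v\<in>verts G. real (out_degree G v) * f v)"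
    by (intro sum.cong refl) (simp add: out_degree_def out_arcs_def)
  also have "\<dots> \<le> (\<Sum>v\<in>verts G. real k * f v)"
    using assms by (intro sum_mono mult_right_mono) auto
  finally show ?thesis
    by (simp add: sum_distrib_left)
qed

text \<open>A nonempty walk is an arc out of \<open>u\<close> followed by a shorter walk, so each
  further step multiplies the number of possible ends by at most \<open>k\<close>.\<close>

lemma (in fin_digraph) card_awalk_ends_le:
  assumes deg: "\<And>v. v \<in> verts G \<Longrightarrow> out_degree G v \<le> k"
  shows "card {v. \<exists>p. awalk u p v \<and> length p = n} \<le> k ^ n"
proof (induction n arbitrary: u)
  case 0
  have "card {v. \<exists>p. awalk u p v \<and> length p = 0} \<le> card {u}"
    by (intro card_mono) (auto simp: awalk_Nil_iff)
  then show ?case by simp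
next
  case (Suc n)
  let ?E = "\<lambda>u n. {v. \<exists>p. awalk u p v \<and> length p = n}"
  show ?case
  proof (cases "u \<in> verts G")
    case True
    have fin: "finite (?E w m)" for w m
      by (rule finite_subset[of _ "verts G"]) auto
    have "?E u (Suc n) \<subseteq> (\<Union>e\<in>out_arcs G u. ?E (head G e) n)"
      by (fastforce simp: length_Suc_conv awalk_Cons_iff)
    then have "card (?E u (Suc n)) \<le> card (\<Union>e\<in>out_arcs G u. ?E (head G e) n)"
      using fin by (intro card_mono) auto
    also have "\<dots> \<le> (\<Sum>e\<in>out_arcs G u. card (?E (head G e) n))"
      by (intro card_UN_le finite_subset[OF _ finite_arcs]) (simp add: out_arcs_def)
    also have "\<dots> \<le> (\<Sum>e\<in>out_arcs G u. k ^ n)"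
      by (intro sum_mono Suc.IH)
    also have "\<dots> \<le> k * k ^ n"
      using deg[OF True] by (simp add: out_degree_def)
    finally show ?thesis by simp
  next
    case False
    then have "?E u (Suc n) = {}"
      by (auto simp: awalk_def)
    then show ?thesis by (simp only: card.empty zero_le)
  qed
qed

text \<open>Distances are attained by walks, so the ball is covered by the ends of walks with fewer
  than \<open>\<lceil>S\<rceil>\<close> arcs. The bound depends on \<open>k\<close> and
  \<open>S\<close> alone and is therefore uniform along the sequence.\<close>

lemma card_graph_ball_le:
  assumes G: "graph G" "Digraph_Component.connected G"
    and deg: "\<And>v. v \<in> verts G \<Longrightarrow> out_degree G v \<le> k"
    and u: "u \<in> verts G"
  shows "card {v \<in> verts G. graph_dist G u v < S} \<le> (\<Sum>n<nat \<lceil>S\<rceil>. k ^ n)"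
proof -
  interpret graph G by fact
  let ?E = "\<lambda>n. {v. \<exists>p. awalk u p v \<and> length p = n}"
  have "{v \<in> verts G. graph_dist G u v < S} \<subseteq> (\<Union>n<nat \<lceil>S\<rceil>. ?E n)"
  proof clarify
    fix v assume v: "v \<in> verts G" "graph_dist G u v < S"
    have "strongly_connected G"
      by (rule symmetric_connected_imp_strongly_connected[OF sym_arcs G(2)])
    then obtain p where "awalk u p v"
      using u v(1) unfolding strongly_connected_def reachable_awalk by blast
    then obtain q where q: "awalk u q v" "graph_dist G u v = real (length q)"
      using graph_dist_le_length(2)[OF G(1)] by blast
    then have "length q < nat \<lceil>S\<rceil>"
      using v(2) by linarith
    then show "v \<in> (\<Union>n<nat \<lceil>S\<rceil>. ?E n)"
      using q(1) by blast
  qed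
  moreover have "finite (?E n)" for n
    by (rule finite_subset[of _ "verts G"]) auto
  ultimately have "card {v \<in> verts G. graph_dist G u v < S} \<le> card (\<Union>n<nat \<lceil>S\<rceil>. ?E n)"
    by (intro card_mono) auto
  also have "\<dots> \<le> (\<Sum>n<nat \<lceil>S\<rceil>. card (?E n))"
    by (intro card_UN_le) simp
  also have "\<dots> \<le> (\<Sum>n<nat \<lceil>S\<rceil>. k ^ n)"
    by (intro sum_mono card_awalk_ends_le deg)
  finally show ?thesis .
qed

text \<open>A real supremum is an upper bound only if the set is bounded above; finiteness of
  \<open>X\<close> ensures this.\<close>

lemma le_space_diameter:
  assumes "finite X" "x \<in> X" "y \<in> X"
  shows "d x y \<le> space_diameter X d"
  unfolding space_diameter_def
  using assms cSUP_upper[of "(x, y)" "X \<times> X" "\<lambda>(x, y). d x y"] by simp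

theorem corollary7p9:
  fixes G :: "nat \<Rightarrow> ('a, 'b) pre_digraph"
  assumes "expander_sequence G"
  shows "\<not> property_A (coarse_union (\<lambda>i. verts (G i)))
             (coarse_union_dist (\<lambda>i. verts (G i)) (\<lambda>i. graph_dist (G i)))"
proof
  let ?X = "coarse_union (\<lambda>i. verts (G i))"
  let ?d = "coarse_union_dist (\<lambda>i. verts (G i)) (\<lambda>i. graph_dist (G i))"
  let ?diam = "\<lambda>i. space_diameter (verts (G i)) (graph_dist (G i))"
  assume "property_A ?X ?d"
  have graph: "graph (G i)" and conn: "Digraph_Component.connected (G i)" for i
    using assms by (simp_all add: expander_sequence_def)
  have lim: "filterlim (\<lambda>i. card (verts (G i))) at_top sequentially"
    using assms by (simp add: expander_sequence_def)
  obtain k \<epsilon> where exp: "\<And>i. expander k \<epsilon> (G i)"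
    using assms by (auto simp: expander_sequence_def)
  have \<epsilon>: "0 < \<epsilon>" and deg: "\<And>i v. v \<in> verts (G i) \<Longrightarrow> out_degree (G i) v \<le> k"
    using exp by (auto simp: expander_def)
  have finV: "finite (verts (G i))" for i
  proof -
    interpret graph "G i" by (rule graph)
    show ?thesis by simp
  qed
  note metric = Metric_space_graph_dist[OF graph conn]

  \<comment> \<open>Each arc will cost at most a fraction \<delta> of the set at its tail, and up to
    \<open>k\<close> arcs share a tail. The summand 1 makes \<open>real k * \<delta>\<close>
    strictly smaller than \<epsilon> and covers \<open>k = 0\<close>.\<close>
  define \<delta> where "\<delta> = \<epsilon> / (real k + 1)"
  have \<delta>: "0 < \<delta>" "real k * \<delta> < \<epsilon>"
    using \<epsilon> by (simp_all add: \<delta>_def field_simps)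
  \<comment> \<open>The radius 2 is chosen because adjacent vertices are at distance at most
    1.\<close>
  have "\<exists>S>0. \<exists>A :: nat \<times> 'a \<Rightarrow> ((nat \<times> 'a) \<times> nat) set.
      (\<forall>x \<in> ?X. finite (A x) \<and> A x \<subseteq> {y \<in> ?X. ?d x y < S} \<times> UNIV) \<and>
      (\<forall>x \<in> ?X. \<forall>y \<in> ?X. ?d x y < 2 \<longrightarrow>
         A x \<inter> A y \<noteq> {} \<and>
         real (card (sym_diff (A x) (A y))) / real (card (A x \<inter> A y)) < \<delta>)"
    using \<open>property_A ?X ?d\<close> \<delta>(1) unfolding property_A_def
    by (elim allE[of _ 2] allE[of _ \<delta>] impE) simp_all
  then obtain S and A :: "nat \<times> 'a \<Rightarrow> ((nat \<times> 'a) \<times> nat) set" where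
    A: "\<forall>x \<in> ?X. finite (A x) \<and> A x \<subseteq> {y \<in> ?X. ?d x y < S} \<times> UNIV"
    and near: "\<forall>x \<in> ?X. \<forall>y \<in> ?X. ?d x y < 2 \<longrightarrow> A x \<inter> A y \<noteq> {} \<and>
       real (card (sym_diff (A x) (A y))) / real (card (A x \<inter> A y)) < \<delta>"
    by (elim exE conjE)
  have fin: "finite (A x)" and ball: "A x \<subseteq> {y \<in> ?X. ?d x y < S} \<times> UNIV" if "x \<in> ?X" for x
    using A that by simp_all

  define M where "M = (\<Sum>n<nat \<lceil>S\<rceil>. k ^ n)"
  \<comment> \<open>With this many vertices, an \<open>S\<close>-ball fills at most half of the
    piece, as the Cheeger bound requires, and is never the whole piece.\<close>
  obtain i where i: "2 * M + 1 \<le> card (verts (G i))"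
    using lim by (auto simp: filterlim_at_top eventually_sequentially)
  interpret graph "G i" by (rule graph)
  define B where "B x = A (i, x)" for x
  have X: "(i, x) \<in> ?X" if "x \<in> verts (G i)" for x
    using that by (simp add: coarse_union_def)
  have ball_le: "card {y \<in> verts (G i). graph_dist (G i) x y < S} \<le> M" if "x \<in> verts (G i)" for x
    unfolding M_def using graph conn deg that by (rule card_graph_ball_le)

  \<comment> \<open>The sets \<open>B x\<close> could a priori reach into other pieces. But a point
    of another piece is at least \<open>?diam i\<close> away from \<open>x\<close>, so the
    \<open>S\<close>-ball around \<open>x\<close> would swallow all of piece \<open>i\<close>, which
    has more than \<open>M\<close> vertices.\<close>
  have support: "j = i \<and> z \<in> verts (G i) \<and> graph_dist (G i) z x < S"
    if x: "x \<in> verts (G i)" and u: "((j, z), n) \<in> B x" for x j z n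
  proof -
    have z: "z \<in> verts (G j)" and dist: "?d (i, x) (j, z) < S"
      using ball[OF X[OF x]] u by (auto simp: B_def coarse_union_def)
    have "j = i"
    proof (rule ccontr)
      assume "j \<noteq> i"
      then have "?diam i + ?diam j < S"
        using dist by (simp add: coarse_union_dist_def)
      moreover have "0 \<le> ?diam j"
        using le_space_diameter[OF finV z z, of "graph_dist (G j)"]
          Metric_space.nonneg[OF metric, of j z z] by linarith
      ultimately have "graph_dist (G i) x y < S" if "y \<in> verts (G i)" for y
        using le_space_diameter[OF finV x that, of "graph_dist (G i)"] by linarith
      then have "{y \<in> verts (G i). graph_dist (G i) x y < S} = verts (G i)"
        by blast
      then show False
        using ball_le[OF x] i by simp
    qed
    then show ?thesis
      using z dist graph_dist_sym[OF graph, of i z x] by (simp add: coarse_union_dist_def)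
  qed
  have small: "2 * card {x \<in> verts (G i). u \<in> B x} \<le> card (verts (G i))" for u
  proof (cases "{x \<in> verts (G i). u \<in> B x} = {}")
    case False
    obtain j z n where u: "u = ((j, z), n)"
      by (cases u) auto
    then have z: "z \<in> verts (G i)"
      using False support by blast
    \<comment> \<open>By symmetry of the metric, all \<open>x\<close> whose set contains
      \<open>u\<close> lie in the \<open>S\<close>-ball around the base point \<open>z\<close> of
      \<open>u\<close>.\<close>
    have "card {x \<in> verts (G i). u \<in> B x} \<le> card {x \<in> verts (G i). graph_dist (G i) z x < S}"
      using support u by (intro card_mono) auto
    then show ?thesis
      using ball_le[OF z] i by linarith
  qed (simp only: card.empty)

  have finB: "finite (B x)" if "x \<in> verts (G i)" for x
    unfolding B_def by (rule fin[OF X[OF that]])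
  have neB: "0 < card (B x)" if "x \<in> verts (G i)" for x
  proof -
    \<comment> \<open>Property A applied to \<open>x\<close> and itself forces the set to be
      nonempty.\<close>
    have "?d (i, x) (i, x) < 2"
      using Metric_space.zero[OF metric that that] by (simp add: coarse_union_dist_def)
    then have "B x \<noteq> {}"
      using near[rule_format, OF X[OF that] X[OF that]] by (simp add: B_def)
    then show ?thesis
      using finB[OF that] by (simp add: card_gt_0_iff)
  qed
  have arc: "real (card (B (tail (G i) e) - B (head (G i) e))) \<le> \<delta> * real (card (B (tail (G i) e)))"
    if e: "e \<in> arcs (G i)" for e
  proof -
    let ?x = "tail (G i) e" and ?y = "head (G i) e"
    have xy: "?x \<in> verts (G i)" "?y \<in> verts (G i)"
      using e by auto
    have "awalk ?x [e] ?y"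
      using e by (simp add: awalk_Cons_iff awalk_Nil_iff)
    from graph_dist_le_length(1)[OF graph this]
    have "?d (i, ?x) (i, ?y) < 2"
      by (simp add: coarse_union_dist_def)
    then have ne: "B ?x \<inter> B ?y \<noteq> {}"
      and ratio: "real (card (sym_diff (B ?x) (B ?y))) / real (card (B ?x \<inter> B ?y)) < \<delta>"
      using near[rule_format, OF X[OF xy(1)] X[OF xy(2)]] by (auto simp: B_def)
    \<comment> \<open>Since division by zero yields 0, the ratio bound carries information only once
      the denominator is known to be positive.\<close>
    have "0 < card (B ?x \<inter> B ?y)"
      using ne finB[OF xy(1)] by (simp add: card_gt_0_iff)
    then have "real (card (sym_diff (B ?x) (B ?y))) < \<delta> * real (card (B ?x \<inter> B ?y))"
      using ratio by (simp add: field_simps)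
    moreover have "card (B ?x - B ?y) \<le> card (sym_diff (B ?x) (B ?y))"
      using finB xy by (intro card_mono) auto
    moreover have "\<delta> * real (card (B ?x \<inter> B ?y)) \<le> \<delta> * real (card (B ?x))"
      using finB xy \<delta>(1) by (intro mult_left_mono of_nat_mono card_mono) auto
    ultimately show ?thesis by linarith
  qed

  let ?T = "\<Sum>x\<in>verts (G i). real (card (B x))"
  have "\<epsilon> * ?T \<le> (\<Sum>e\<in>arcs (G i). real (card (B (tail (G i) e) - B (head (G i) e))))"
    using exp finB small by (rule expander_sum_card_le)
  also have "\<dots> \<le> (\<Sum>e\<in>arcs (G i). \<delta> * real (card (B (tail (G i) e))))"
    by (intro sum_mono arc)
  also have "\<dots> = \<delta> * (\<Sum>e\<in>arcs (G i). real (card (B (tail (G i) e))))"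
    by (simp add: sum_distrib_left)
  also have "\<dots> \<le> \<delta> * (real k * ?T)"
    using \<delta>(1) deg by (intro mult_left_mono sum_arcs_tail_le) auto
  finally have "\<epsilon> * ?T \<le> (real k * \<delta>) * ?T"
    by (simp add: mult_ac)
  \<comment> \<open>Cancelling \<open>?T\<close> leaves
    \<open>\<epsilon> \<le> real k * \<delta>\<close>, against the choice of \<delta>.\<close>
  moreover have "0 < ?T"
    using i neB finV[of i] by (intro sum_pos) auto
  ultimately show False
    using \<delta>(2) by simp
qed

end
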